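(* Suppose that a binary quadratic form $F$ is composed of integer binary quadratic forms $f$ and $f'$. Then $F$ is also an integer form. Moreover, we have $$\delta(F)=\delta(f)\,\delta(f'),\qquad \sigma(F)=\min(\sigma(f),\sigma(f')),\qquad \theta(F)=\gcd(\theta(f),\theta(f')).$$
   Context: A binary quadratic form is a function $f(x,y)=ax^2+bxy+cy^2$, where $a,b,c$ are given (real) numbers; it is written $(a,b,c)$ and regarded as a function on $\mathbb{Z}^2$. It is integer if $a,b,c\in\mathbb{Z}$ (equivalently, $f(\mathbf{x})\in\mathbb{Z}$ for all $\mathbf{x}\in\mathbb{Z}^2$). Composition: let $\circ:\mathbb{Z}^2\times\mathbb{Z}^2\to\mathbb{Z}^2$ be a bilinear map, and let $f,f',F$ be binary quadratic forms on $\mathbb{Z}^2$ such that $F(\mathbf{x}\circ\mathbf{x}')=f(\mathbf{x})f'(\mathbf{x}')$ for all $\mathbf{x},\mathbf{x}'\in\mathbb{Z}^2$. Suppose additionally that the vectors $\mathbf{x}\circ\mathbf{x}'$ span $\mathbb{Z}^2$. Then $\circ$ is called a composition law, and $F$ is said to be composed of $f$ and $f'$. (The form $F$ is a priori not assumed to be integer.) Invariants of an integer form $f=(a,b,c)$: $\delta(f)=\gcd(a,b,c)$ is the greatest common divisor of all values of $f$ on $\mathbb{Z}^2$; $\delta'(f)=\gcd(2a,b,2c)$ is the greatest common divisor of all doubled inner products $2f(\mathbf{x},\mathbf{y})$, where $f(\mathbf{x},\mathbf{y})$ is the symmetric bilinear functional with $f(\mathbf{x},\mathbf{x})=f(\mathbf{x})$;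 $\sigma(f)=\delta'(f)/\delta(f)$, which equals $1$ or $2$; $d(f)=b^2-4ac$ is the discriminant, which is divisible by $\delta(f)^2$; and $\theta(f)=d(f)/\delta(f)^2$.
   Formalization: In the formula for θ(F) the gcd is given the common sign of θ(f) and θ(f') (with a nonnegative gcd it fails for x²+y² composed with itself, where θ(F) = −4), and the formulas for σ and θ are stated for f and f' nonzero, since σ and θ are undefined for the zero form. *)

theory Defs
  imports Complex_Main "HOL-Library.Product_Plus"
begin

datatype bqf = BQF (coeff_a: real) (coeff_b: real) (coeff_c: real)

definition bqf_val :: "bqf \<Rightarrow> int \<times> int \<Rightarrow> real" where
  "bqf_val f v = coeff_a f * real_of_int (fst v) ^ 2
     + coeff_b f * real_of_int (fst v) * real_of_int (snd v)
     + coeff_c f * real_of_int (snd v) ^ 2"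

definition integer_form :: "bqf \<Rightarrow> bool" where
  "integer_form f \<longleftrightarrow> coeff_a f \<in> \<int> \<and> coeff_b f \<in> \<int> \<and> coeff_c f \<in> \<int>"


subsection \<open>Composition\<close>

definition zscale :: "int \<Rightarrow> int \<times> int \<Rightarrow> int \<times> int" where
  "zscale k v = (k * fst v, k * snd v)"

interpretation Z2: module zscale
  by unfold_locales (auto simp: zscale_def prod_eq_iff algebra_simps)

definition Z2_bilinear :: "(int \<times> int \<Rightarrow> int \<times> int \<Rightarrow> int \<times> int) \<Rightarrow> bool" where
  "Z2_bilinear m \<longleftrightarrow>
     (\<forall>x. module_hom zscale zscale (\<lambda>x'. m x x')) \<and>
     (\<forall>x'. module_hom zscale zscale (\<lambda>x. m x x'))"

definition composition_law ::
  "(int \<times> int \<Rightarrow> int \<times> int \<Rightarrow> int \<times> int) \<Rightarrow> bqf \<Rightarrow> bqf \<Rightarrow> bqf \<Rightarrow> bool" where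
  "composition_law m f f' F \<longleftrightarrow>
     Z2_bilinear m \<and>
     (\<forall>x x'. bqf_val F (m x x') = bqf_val f x * bqf_val f' x') \<and>
     Z2.span {m x x' | x x'. True} = UNIV"

definition composed_of :: "bqf \<Rightarrow> bqf \<Rightarrow> bqf \<Rightarrow> bool" where
  "composed_of F f f' \<longleftrightarrow> (\<exists>m. composition_law m f f' F)"


subsection \<open>Invariants of integer forms\<close>

text \<open>
  The invariants are meaningful for integer forms only. There every floor below is applied to an
  integer and merely changes the type, and both divisions are exact for nonzero forms
  (see the lemmas at the end). For the zero form, \<open>\<sigma>\<close> and \<open>\<theta>\<close> are undefined
  in the mathematical sense.
\<close>

definition delta :: "bqf \<Rightarrow> int" where
  "delta f = gcd \<lfloor>coeff_a f\<rfloor> (gcd \<lfloor>coeff_b f\<rfloor> \<lfloor>coeff_c f\<rfloor>)"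

definition delta' :: "bqf \<Rightarrow> int" where
  "delta' f = gcd \<lfloor>2 * coeff_a f\<rfloor> (gcd \<lfloor>coeff_b f\<rfloor> \<lfloor>2 * coeff_c f\<rfloor>)"

definition sigma :: "bqf \<Rightarrow> int" where
  "sigma f = delta' f div delta f"

definition disc :: "bqf \<Rightarrow> real" where
  "disc f = coeff_b f ^ 2 - 4 * coeff_a f * coeff_c f"

definition theta :: "bqf \<Rightarrow> int" where
  "theta f = \<lfloor>disc f\<rfloor> div delta f ^ 2"

text \<open>
  Discriminants may be negative, whereas the library's \<open>gcd\<close> is never negative.
  (For \<open>x\<^sup>2 + y\<^sup>2\<close> composed with itself by complex multiplication, all three
  values of \<open>\<theta>\<close> are \<open>-4\<close>.) So the greatest common divisor of discriminants carries their
  sign. In a composition of nonzero forms, \<open>\<theta>(f)\<close> and \<open>\<theta>(f')\<close> are square multiples of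
  \<open>\<theta>(F)\<close>, so they never have strictly opposite signs, and the value chosen here for
  that case is immaterial.
\<close>

definition signed_gcd :: "int \<Rightarrow> int \<Rightarrow> int" where
  "signed_gcd m n = (if m \<le> 0 \<and> n \<le> 0 then - gcd m n else gcd m n)"

lemma integer_formE:
  assumes "integer_form f"
  obtains a b c where "f = BQF (real_of_int a) (real_of_int b) (real_of_int c)"
  using assms by (cases f) (auto simp: integer_form_def elim!: Ints_cases)

lemma invariants_of_int:
  fixes a b c :: int
  defines "f \<equiv> BQF (real_of_int a) (real_of_int b) (real_of_int c)"
  shows "delta f = gcd a (gcd b c)"
    and "delta' f = gcd (2 * a) (gcd b (2 * c))"
    and "disc f = real_of_int (b ^ 2 - 4 * a * c)"
    and "theta f = (b ^ 2 - 4 * a * c) div (gcd a (gcd b c)) ^ 2"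
proof -
  have fl: "\<lfloor>2 * real_of_int n\<rfloor> = 2 * n" for n
    by (metis floor_of_int of_int_mult of_int_numeral)
  show d: "delta f = gcd a (gcd b c)" by (simp add: f_def delta_def)
  show "delta' f = gcd (2 * a) (gcd b (2 * c))" by (simp add: f_def delta'_def fl)
  show "disc f = real_of_int (b ^ 2 - 4 * a * c)" by (simp add: f_def disc_def)
  then show "theta f = (b ^ 2 - 4 * a * c) div (gcd a (gcd b c)) ^ 2"
    using d by (simp only: theta_def floor_of_int)
qed

lemma sigma_exact:
  assumes "integer_form f"
  shows "sigma f * delta f = delta' f"
proof -
  obtain a b c where f: "f = BQF (real_of_int a) (real_of_int b) (real_of_int c)"
    using assms by (rule integer_formE)
  have "delta f dvd delta' f"
    unfolding f invariants_of_int by (meson dvd_mult gcd_greatest gcd_dvd1 gcd_dvd2 dvd_trans)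
  then show ?thesis by (simp add: sigma_def)
qed

lemma theta_exact:
  assumes "integer_form f"
  shows "real_of_int (theta f * delta f ^ 2) = disc f"
proof -
  obtain a b c where f: "f = BQF (real_of_int a) (real_of_int b) (real_of_int c)"
    using assms by (rule integer_formE)
  let ?g = "gcd a (gcd b c)"
  have g: "?g dvd a" "?g dvd b" "?g dvd c"
    by (meson gcd_dvd1 gcd_dvd2 dvd_trans)+
  have "?g ^ 2 dvd b ^ 2" using g(2) by (rule dvd_power_same)
  moreover have "?g ^ 2 dvd 4 * (a * c)"
    unfolding power2_eq_square using g(1,3) by (intro dvd_mult mult_dvd_mono)
  ultimately have "?g ^ 2 dvd b ^ 2 - 4 * a * c"
    by (simp only: mult.assoc dvd_diff)
  then show ?thesis unfolding f invariants_of_int by (simp only: dvd_div_mult_self)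
qed

end

theory Submission
  imports Defs "HOL-Computational_Algebra.Primes"
begin

text \<open>Dividing out contents, let \<open>f = (a, b, c)\<close> and \<open>f' = (a', b', c')\<close> be primitive, and let
  \<open>v1, \<dots>, v4\<close> be the products of the basis vectors. Their Gram matrix with respect to the polar form
  of \<open>F\<close> is determined by \<open>f\<close> and \<open>f'\<close> except for two entries \<open>s\<close>, \<open>t\<close> with \<open>s + t = b b'\<close>. As its
  rank is at most 2, \<open>s\<close> and \<open>t\<close> are the roots of a monic integer polynomial with discriminant
  \<open>d(f) d(f')\<close>. By Cauchy--Binet the \<open>2 \<times> 2\<close> minors of \<open>(v1, \<dots>, v4)\<close> give integers \<open>n\<close>, \<open>n'\<close> with
  \<open>d(f') = n\<^sup>2 d(F)\<close> and \<open>d(f) = n'\<^sup>2 d(F)\<close>; they are coprime if \<open>d(F) \<noteq> 0\<close>, since by the Pluecker relation a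
  common prime factor would divide all six minors, contradicting the span condition. So
  \<open>d(f) d(f')\<close> is a square and \<open>s\<close>, \<open>t\<close> are integers, which makes \<open>F\<close> integer. Content and parity of
  \<open>F\<close> are then read off the Gram matrix, and \<open>\<theta>\<close> off the coprimality of \<open>n\<close> and \<open>n'\<close>.\<close>

section \<open>Polar form and determinant on the integer plane\<close>

text \<open>Twice the inner product of \<open>F\<close>: integral for integer forms, and equal to
  the middle coefficient on the pair of standard basis vectors.\<close>

definition polar :: "bqf \<Rightarrow> int \<times> int \<Rightarrow> int \<times> int \<Rightarrow> real" where
  "polar F u w = 2 * coeff_a F * fst u * fst w
     + coeff_b F * (fst u * snd w + snd u * fst w) + 2 * coeff_c F * snd u * snd w"

definition wedge :: "int \<times> int \<Rightarrow> int \<times> int \<Rightarrow> int" where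
  "wedge u w = fst u * snd w - snd u * fst w"

lemma polar_sym: "polar F u w = polar F w u"
  by (simp add: polar_def algebra_simps)

lemma polar_self: "polar F u u = 2 * bqf_val F u"
  by (simp add: polar_def bqf_val_def algebra_simps power2_eq_square)

lemma bqf_val_add: "bqf_val F (u + w) = bqf_val F u + bqf_val F w + polar F u w"
  by (simp add: polar_def bqf_val_def algebra_simps power2_eq_square)

lemma polar_add_left: "polar F (u + v) w = polar F u w + polar F v w"
  and polar_add_right: "polar F w (u + v) = polar F w u + polar F w v"
  by (simp_all add: polar_def algebra_simps)

lemma polar_zscale_left: "polar F (zscale k u) w = k * polar F u w"
  and polar_zscale_right: "polar F w (zscale k u) = k * polar F w u"
  by (simp_all add: polar_def zscale_def algebra_simps)

lemma zscale_0 [simp]: "zscale 0 u = 0"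
  and zscale_1 [simp]: "zscale 1 u = u"
  by (simp_all add: zscale_def prod_eq_iff)

lemma bqf_val_zscale: "bqf_val F (zscale k u) = k\<^sup>2 * bqf_val F u"
  by (simp add: bqf_val_def zscale_def algebra_simps power2_eq_square)

text \<open>In the standard basis \<open>polar F\<close> has a matrix of determinant
  \<open>- disc F\<close>, so this is multiplicativity of 2 x 2 determinants.\<close>

lemma polar_Cauchy_Binet:
  "polar F u w * polar F u' w' - polar F u w' * polar F u' w = - disc F * (wedge u u' * wedge w w')"
  by (simp add: polar_def disc_def wedge_def algebra_simps power2_eq_square)

text \<open>\<open>M\<close> is the product of a two-column and a two-row matrix, so its 3 x 3
  minors vanish.\<close>

lemma det3_rank2:
  fixes M :: "'a \<Rightarrow> 'b \<Rightarrow> 'c::comm_ring"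
  assumes "\<And>i j. M i j = x i * y j + z i * t j"
  shows "M i1 j1 * (M i2 j2 * M i3 j3 - M i2 j3 * M i3 j2)
       - M i1 j2 * (M i2 j1 * M i3 j3 - M i2 j3 * M i3 j1)
       + M i1 j3 * (M i2 j1 * M i3 j2 - M i2 j2 * M i3 j1) = 0"
  unfolding assms by (simp add: algebra_simps)

lemma polar_det3:
  "polar F i1 j1 * (polar F i2 j2 * polar F i3 j3 - polar F i2 j3 * polar F i3 j2)
       - polar F i1 j2 * (polar F i2 j1 * polar F i3 j3 - polar F i2 j3 * polar F i3 j1)
       + polar F i1 j3 * (polar F i2 j1 * polar F i3 j2 - polar F i2 j2 * polar F i3 j1) = 0"
  by (rule det3_rank2[where M = "polar F"
        and x = "\<lambda>u. 2 * coeff_a F * real_of_int (fst u) + coeff_b F * real_of_int (snd u)"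
        and y = "\<lambda>w. real_of_int (fst w)"
        and z = "\<lambda>u. coeff_b F * real_of_int (fst u) + 2 * coeff_c F * real_of_int (snd u)"
        and t = "\<lambda>w. real_of_int (snd w)"])
     (simp add: polar_def algebra_simps)

lemma wedge_Pluecker:
  "wedge u v * wedge w x - wedge u w * wedge v x + wedge u x * wedge v w = 0"
  by (simp add: wedge_def algebra_simps)

section \<open>Primitive vectors and rank one matrices\<close>

lemma primitive_Bezout:
  fixes a b c :: int
  assumes "gcd a (gcd b c) = 1"
  obtains r s t where "r * a + s * b + t * c = 1"
proof -
  obtain x y where 1: "x * a + y * gcd b c = 1" using bezout_int assms by metis
  obtain z w where 2: "z * b + w * c = gcd b c" using bezout_int by metis
  have "x * a + (y * z) * b + (y * w) * c = 1"
    using 1 2[symmetric] by (simp add: algebra_simps)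
  then show thesis by (rule that)
qed

lemma composition_law_flip:
  assumes "composition_law m f f' F"
  shows "composition_law (\<lambda>x y. m y x) f' f F"
proof -
  have "{m y x |x y. True} = {m x y |x y. True}" by blast
  with assms show ?thesis
    unfolding composition_law_def Z2_bilinear_def by (simp add: mult.commute)
qed

text \<open>The hypotheses equate \<open>D\<close> times the symmetric square of w with
  \<open>e\<close> times that of the primitive vector g. Let r be a Bezout vector for g and
  \<open>n\<close> the contraction of w with r. Contracting once gives
  \<open>D * n * w = e * g\<close>, twice \<open>D * n^2 = e\<close>.\<close>

lemma rank_one_scaling:
  fixes D e :: real and w1 w2 w3 g1 g2 g3 :: int
  assumes "gcd g1 (gcd g2 g3) = 1"
    and 11: "D * (w1 * w1) = e * (g1 * g1)" and 12: "D * (w1 * w2) = e * (g1 * g2)"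
    and 13: "D * (w1 * w3) = e * (g1 * g3)" and 22: "D * (w2 * w2) = e * (g2 * g2)"
    and 23: "D * (w2 * w3) = e * (g2 * g3)" and 33: "D * (w3 * w3) = e * (g3 * g3)"
  obtains n :: int where "e = D * n\<^sup>2"
    and "D \<noteq> 0 \<Longrightarrow> w1 = n * g1 \<and> w2 = n * g2 \<and> w3 = n * g3"
proof -
  obtain r1 r2 r3 where "r1 * g1 + r2 * g2 + r3 * g3 = 1"
    using assms(1) by (rule primitive_Bezout)
  then have r: "r1 * real_of_int g1 + r2 * real_of_int g2 + r3 * real_of_int g3 = 1"
    by (metis of_int_1 of_int_add of_int_mult)
  define n where "n = r1 * w1 + r2 * w2 + r3 * w3"
  have n: "real_of_int n = r1 * real_of_int w1 + r2 * real_of_int w2 + r3 * real_of_int w3"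
    by (simp add: n_def)
  note eqs = 11 12 13 22 23 33
  have w: "D * (w1 * n) = e * g1" "D * (w2 * n) = e * g2" "D * (w3 * n) = e * g3"
    using eqs r n unfolding of_int_mult by algebra+
  then have e: "e = D * n\<^sup>2"
    using r n unfolding of_int_mult of_int_power by algebra
  have "w1 = n * g1 \<and> w2 = n * g2 \<and> w3 = n * g3" if "D \<noteq> 0"
  proof (cases "n = 0")
    \<comment> \<open>Here \<open>e = 0\<close>, so every \<open>D * w^2\<close> vanishes and w is
      zero.\<close>
    case True
    then show ?thesis using e 11 22 33 that by simp
  next
    case False
    have "w = n * g" if "D * (w * n) = e * g" for w g
    proof -
      have "D * n * real_of_int w = D * n * real_of_int (n * g)"
        using that by (simp add: e power2_eq_square algebra_simps)
      then have "real_of_int w = real_of_int (n * g)" using \<open>D \<noteq> 0\<close> False by simp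
      then show ?thesis by (simp only: of_int_eq_iff)
    qed
    with w show ?thesis by blast
  qed
  with e show thesis by (rule that)
qed

section \<open>Composition laws in coordinates\<close>

locale composition =
  fixes m :: "int \<times> int \<Rightarrow> int \<times> int \<Rightarrow> int \<times> int" and a b c a' b' c' :: int and F :: bqf
  assumes law: "composition_law m (BQF a b c) (BQF a' b' c') F"
begin

definition v1 where "v1 = m (1, 0) (1, 0)"
definition v2 where "v2 = m (1, 0) (0, 1)"
definition v3 where "v3 = m (0, 1) (1, 0)"
definition v4 where "v4 = m (0, 1) (0, 1)"

lemma m_expand:
  "m x y = zscale (fst x * fst y) v1 + zscale (fst x * snd y) v2
     + zscale (snd x * fst y) v3 + zscale (snd x * snd y) v4"
proof -
  have L: "module_hom zscale zscale (m x)" for x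
    using law unfolding composition_law_def Z2_bilinear_def by blast
  have R: "module_hom zscale zscale (\<lambda>x. m x y)" for y
    using law unfolding composition_law_def Z2_bilinear_def by blast
  have dec: "z = zscale (fst z) (1, 0) + zscale (snd z) (0, 1)" for z
    by (simp add: zscale_def prod_eq_iff)
  have "m x y = zscale (fst x) (m (1, 0) y) + zscale (snd x) (m (0, 1) y)"
    by (subst dec[of x]) (simp only: module_hom.add[OF R] module_hom.scale[OF R])
  moreover have "m z y = zscale (fst y) (m z (1, 0)) + zscale (snd y) (m z (0, 1))" for z
    by (subst dec[of y]) (simp only: module_hom.add[OF L] module_hom.scale[OF L])
  ultimately show ?thesis
    by (simp add: v1_def v2_def v3_def v4_def prod_eq_iff zscale_def algebra_simps)
qed

lemma mult_val: "bqf_val F (m x y) = bqf_val (BQF a b c) x * bqf_val (BQF a' b' c') y"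
  using law unfolding composition_law_def by blast

text \<open>By \<open>m_expand\<close> the subgroup generated by these four vectors contains all
  products, so the span condition makes it everything. This extends bilinear facts from the four
  vectors to all of them.\<close>

lemma span_coords:
  obtains k1 k2 k3 k4 where
    "u = zscale k1 v1 + zscale k2 v2 + zscale k3 v3 + zscale k4 v4"
proof -
  let ?S = "{zscale k1 v1 + zscale k2 v2 + zscale k3 v3 + zscale k4 v4 |k1 k2 k3 k4. True}"
  have "Z2.subspace ?S"
    unfolding Z2.subspace_def
  proof (intro conjI ballI allI)
    have "0 = zscale 0 v1 + zscale 0 v2 + zscale 0 v3 + zscale 0 v4"
      by (simp add: zscale_def prod_eq_iff)
    then show "0 \<in> ?S" by blast
  next
    fix x y assume "x \<in> ?S" "y \<in> ?S"
    then obtain k1 k2 k3 k4 l1 l2 l3 l4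
      where x: "x = zscale k1 v1 + zscale k2 v2 + zscale k3 v3 + zscale k4 v4"
        and y: "y = zscale l1 v1 + zscale l2 v2 + zscale l3 v3 + zscale l4 v4" by blast
    have "x + y = zscale (k1 + l1) v1 + zscale (k2 + l2) v2 + zscale (k3 + l3) v3 + zscale (k4 + l4) v4"
      unfolding x y by (simp add: zscale_def prod_eq_iff algebra_simps)
    then show "x + y \<in> ?S" by blast
  next
    fix k x assume "x \<in> ?S"
    then obtain k1 k2 k3 k4
      where x: "x = zscale k1 v1 + zscale k2 v2 + zscale k3 v3 + zscale k4 v4" by blast
    have "zscale k x = zscale (k * k1) v1 + zscale (k * k2) v2 + zscale (k * k3) v3 + zscale (k * k4) v4"
      unfolding x by (simp add: zscale_def prod_eq_iff algebra_simps)
    then show "zscale k x \<in> ?S" by blast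
  qed
  moreover have "{m x x' |x x'. True} \<subseteq> ?S" using m_expand by blast
  ultimately have "Z2.span {m x x' |x x'. True} \<subseteq> ?S" by (rule Z2.span_minimal[rotated])
  moreover have "Z2.span {m x x' |x x'. True} = UNIV"
    using law unfolding composition_law_def by blast
  ultimately have "u \<in> ?S" by (simp only: UNIV_I subset_iff)
  then show thesis using that by blast
qed

section \<open>The Gram matrix of the four basis products\<close>

definition s where "s = polar F v2 v3"
definition t where "t = polar F v1 v4"

lemma val_v:
  "bqf_val F v1 = a * a'" "bqf_val F v2 = a * c'" "bqf_val F v3 = c * a'" "bqf_val F v4 = c * c'"
  unfolding v1_def v2_def v3_def v4_def mult_val by (simp_all add: bqf_val_def)

text \<open>An off-diagonal entry other than \<open>s\<close> and \<open>t\<close> pairs two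
  products with a common factor. It results from evaluating \<open>F\<close> on the product of that
  factor with (1,1) and polarising.\<close>

lemma polar_v:
  "polar F v1 v1 = 2 * a * a'" "polar F v1 v2 = a * b'" "polar F v1 v3 = b * a'" "polar F v1 v4 = t"
  "polar F v2 v1 = a * b'" "polar F v2 v2 = 2 * a * c'" "polar F v2 v3 = s" "polar F v2 v4 = b * c'"
  "polar F v3 v1 = b * a'" "polar F v3 v2 = s" "polar F v3 v3 = 2 * c * a'" "polar F v3 v4 = c * b'"
  "polar F v4 v1 = t" "polar F v4 v2 = b * c'" "polar F v4 v3 = c * b'" "polar F v4 v4 = 2 * c * c'"
proof -
  have 12: "polar F v1 v2 = a * b'"
  proof -
    have "bqf_val F (v1 + v2) = a * (a' + b' + c')"
      using mult_val[of "(1,0)" "(1,1)"] m_expand[of "(1,0)" "(1,1)"] by (simp add: bqf_val_def)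
    then show ?thesis by (simp add: bqf_val_add val_v algebra_simps)
  qed
  have 34: "polar F v3 v4 = c * b'"
  proof -
    have "bqf_val F (v3 + v4) = c * (a' + b' + c')"
      using mult_val[of "(0,1)" "(1,1)"] m_expand[of "(0,1)" "(1,1)"] by (simp add: bqf_val_def)
    then show ?thesis by (simp add: bqf_val_add val_v algebra_simps)
  qed
  have 13: "polar F v1 v3 = b * a'"
  proof -
    have "bqf_val F (v1 + v3) = (a + b + c) * a'"
      using mult_val[of "(1,1)" "(1,0)"] m_expand[of "(1,1)" "(1,0)"] by (simp add: bqf_val_def)
    then show ?thesis by (simp add: bqf_val_add val_v algebra_simps)
  qed
  have 24: "polar F v2 v4 = b * c'"
  proof -
    have "bqf_val F (v2 + v4) = (a + b + c) * c'"
      using mult_val[of "(1,1)" "(0,1)"] m_expand[of "(1,1)" "(0,1)"] by (simp add: bqf_val_def)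
    then show ?thesis by (simp add: bqf_val_add val_v algebra_simps)
  qed
  show "polar F v1 v1 = 2 * a * a'" "polar F v1 v2 = a * b'" "polar F v1 v3 = b * a'" "polar F v1 v4 = t"
  "polar F v2 v1 = a * b'" "polar F v2 v2 = 2 * a * c'" "polar F v2 v3 = s" "polar F v2 v4 = b * c'"
  "polar F v3 v1 = b * a'" "polar F v3 v2 = s" "polar F v3 v3 = 2 * c * a'" "polar F v3 v4 = c * b'"
  "polar F v4 v1 = t" "polar F v4 v2 = b * c'" "polar F v4 v3 = c * b'" "polar F v4 v4 = 2 * c * c'"
    using 12 34 13 24
    by (simp_all add: polar_self val_v s_def t_def polar_sym[of F v2 v1] polar_sym[of F v3 v1]
        polar_sym[of F v4] polar_sym[of F v3 v2])
qed

lemma s_plus_t: "s + t = b * b'"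
proof -
  have "bqf_val F (v1 + v2 + v3 + v4) = (a + b + c) * (a' + b' + c')"
    using mult_val[of "(1,1)" "(1,1)"] m_expand[of "(1,1)" "(1,1)"] by (simp add: bqf_val_def)
  then show ?thesis
    by (simp add: bqf_val_add polar_add_left polar_add_right polar_v val_v algebra_simps)
qed

text \<open>The \<open>3 \<times> 3\<close> minors of the Gram matrix of \<open>v1, \<dots>, v4\<close> vanish, as these vectors lie in a
  plane. Each minor is, up to sign, the difference of both sides here times an entry of the Gram
  matrix with \<open>s\<close> and \<open>t\<close> swapped.\<close>

lemma s_times_t: "s * t = a' * c' * b\<^sup>2 + a * c * b'\<^sup>2 - 4 * a * c * a' * c'"
proof (rule ccontr)
  define E :: real where "E = s * t - (a' * c' * b\<^sup>2 + a * c * b'\<^sup>2 - 4 * a * c * a' * c')"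
  assume "\<not> ?thesis"
  then have "E \<noteq> 0" by (simp add: E_def)
  have t: "t = b * b' - s" using s_plus_t by linarith
  have "E * (a * a') = 0"
    using polar_det3[of F v1 v1 v2 v2 v3 v3]
    by (simp only: polar_v E_def t of_int_mult of_int_power of_int_add of_int_diff of_int_numeral) algebra
  moreover have "E * (c * c') = 0"
    using polar_det3[of F v2 v2 v3 v3 v4 v4]
    by (simp only: polar_v E_def t of_int_mult of_int_power of_int_add of_int_diff of_int_numeral) algebra
  moreover have "E * (a * b') = 0"
    using polar_det3[of F v1 v1 v2 v2 v3 v4]
    by (simp only: polar_v E_def t of_int_mult of_int_power of_int_add of_int_diff of_int_numeral) algebra
  moreover have "E * (b * a') = 0"
    using polar_det3[of F v1 v1 v2 v3 v3 v4]
    by (simp only: polar_v E_def t of_int_mult of_int_power of_int_add of_int_diff of_int_numeral) algebra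
  moreover have "E * s = 0 \<or> E * t = 0"
    using polar_det3[of F v1 v2 v2 v3 v3 v4]
    by (simp only: polar_v E_def t of_int_mult of_int_power of_int_add of_int_diff of_int_numeral) algebra
  ultimately have "(a = 0 \<or> a' = 0) \<and> (c = 0 \<or> c' = 0) \<and> (a = 0 \<or> b' = 0)
      \<and> (b = 0 \<or> a' = 0) \<and> (s = 0 \<or> t = 0)"
    using \<open>E \<noteq> 0\<close> by simp
  \<comment> \<open>Each term of \<open>E\<close> contains a product that has just been shown to
    vanish.\<close>
  then have "E = 0" unfolding E_def by auto
  then show False using \<open>E \<noteq> 0\<close> by simp
qed

section \<open>The 2 x 2 minors of the four basis products\<close>

text \<open>\<open>wedge v1 v2\<close>, \<open>w2\<close> and \<open>wedge v3 v4\<close> are the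
  coefficients of the determinant of \<open>m x\<close> as a quadratic form in \<open>x\<close>.
  Since \<open>F\<close> pulled back along \<open>m x\<close> is f(x) f', comparing discriminants
  shows that \<open>disc F\<close> times the squared determinant is \<open>e\<close> times f(x)^2.
  The lemma refines this to the single products of coefficients.\<close>

lemma wedge_products:
  fixes e :: real
  defines "e \<equiv> b'\<^sup>2 - 4 * a' * c'"
    and "w2 \<equiv> wedge v1 v4 - wedge v2 v3"
  shows "disc F * (wedge v1 v2 * wedge v1 v2) = e * (a * a)"
    and "disc F * (wedge v1 v2 * w2) = e * (a * b)"
    and "disc F * (wedge v1 v2 * wedge v3 v4) = e * (a * c)"
    and "disc F * (w2 * w2) = e * (b * b)"
    and "disc F * (w2 * wedge v3 v4) = e * (b * c)"
    and "disc F * (wedge v3 v4 * wedge v3 v4) = e * (c * c)"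
proof -
  have t: "t = b * b' - s" using s_plus_t by linarith
  have st: "s * (b * b' - s) = a' * c' * b\<^sup>2 + a * c * b'\<^sup>2 - 4 * a * c * a' * c'"
    using s_times_t t by simp
  show "disc F * (wedge v1 v2 * wedge v1 v2) = e * (a * a)"
    using polar_Cauchy_Binet[of F v1 v1 v2 v2]
    by (simp only: polar_v e_def of_int_mult of_int_diff of_int_add of_int_power of_int_numeral) algebra
  show "disc F * (wedge v1 v2 * w2) = e * (a * b)"
    using polar_Cauchy_Binet[of F v1 v1 v2 v4] polar_Cauchy_Binet[of F v1 v2 v2 v3]
    by (simp only: polar_v e_def w2_def t of_int_mult of_int_diff of_int_add of_int_power of_int_numeral) algebra
  \<comment> \<open>The Gram minor with rows \<open>v1\<close>, \<open>v2\<close> and columns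
    \<open>v3\<close>, \<open>v4\<close> contains \<open>s * t\<close>, which \<open>st\<close>
    evaluates.\<close>
  show "disc F * (wedge v1 v2 * wedge v3 v4) = e * (a * c)"
    using polar_Cauchy_Binet[of F v1 v3 v2 v4] st
    by (simp only: polar_v e_def t of_int_mult of_int_diff of_int_add of_int_power of_int_numeral) algebra
  show "disc F * (w2 * w2) = e * (b * b)"
    using polar_Cauchy_Binet[of F v1 v1 v4 v4] polar_Cauchy_Binet[of F v2 v2 v3 v3]
      polar_Cauchy_Binet[of F v1 v2 v4 v3] st
    by (simp only: polar_v e_def w2_def t of_int_mult of_int_diff of_int_add of_int_power of_int_numeral) algebra
  show "disc F * (w2 * wedge v3 v4) = e * (b * c)"
    using polar_Cauchy_Binet[of F v1 v3 v4 v4] polar_Cauchy_Binet[of F v2 v3 v3 v4]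
    by (simp only: polar_v e_def w2_def t of_int_mult of_int_diff of_int_add of_int_power of_int_numeral) algebra
  show "disc F * (wedge v3 v4 * wedge v3 v4) = e * (c * c)"
    using polar_Cauchy_Binet[of F v3 v3 v4 v4]
    by (simp only: polar_v e_def of_int_mult of_int_diff of_int_add of_int_power of_int_numeral) algebra
qed

text \<open>For nonzero \<open>disc F\<close> this says that the determinant of \<open>m x\<close>
  is \<open>n\<close> times f(x).\<close>

lemma left_scaling:
  assumes "gcd a (gcd b c) = 1"
  obtains n :: int where "b'\<^sup>2 - 4 * a' * c' = disc F * n\<^sup>2"
    and "disc F \<noteq> 0 \<Longrightarrow>
      wedge v1 v2 = n * a \<and> wedge v1 v4 - wedge v2 v3 = n * b \<and> wedge v3 v4 = n * c"
  using rank_one_scaling[OF assms wedge_products] by auto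

lemma right_scaling:
  assumes "gcd a' (gcd b' c') = 1"
  obtains n :: int where "b\<^sup>2 - 4 * a * c = disc F * n\<^sup>2"
    and "disc F \<noteq> 0 \<Longrightarrow>
      wedge v1 v3 = n * a' \<and> wedge v1 v4 + wedge v2 v3 = n * b' \<and> wedge v2 v4 = n * c'"
proof -
  \<comment> \<open>Exchanging the factors swaps \<open>v2\<close> and \<open>v3\<close>, which
    turns the difference of the two middle minors into their sum.\<close>
  interpret flip: composition "\<lambda>x y. m y x" a' b' c' a b c F
    using law by unfold_locales (rule composition_law_flip)
  have "flip.v1 = v1" "flip.v2 = v3" "flip.v3 = v2" "flip.v4 = v4"
    by (simp_all add: v1_def v2_def v3_def v4_def flip.v1_def flip.v2_def flip.v3_def flip.v4_def)
  moreover have "wedge v3 v2 = - wedge v2 v3" by (simp add: wedge_def)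
  ultimately show thesis
    using flip.left_scaling[OF assms] that by auto
qed

text \<open>\<open>wedge\<close> is bilinear and alternating, and the four vectors generate. Since
  the standard basis has wedge 1, no prime divides all six minors.\<close>

lemma wedge_dvd:
  assumes "p dvd wedge v1 v2" "p dvd wedge v1 v3" "p dvd wedge v1 v4"
    and "p dvd wedge v2 v3" "p dvd wedge v2 v4" "p dvd wedge v3 v4"
  shows "p dvd wedge u w"
proof -
  obtain k1 k2 k3 k4 where u: "u = zscale k1 v1 + zscale k2 v2 + zscale k3 v3 + zscale k4 v4"
    by (rule span_coords)
  obtain l1 l2 l3 l4 where w: "w = zscale l1 v1 + zscale l2 v2 + zscale l3 v3 + zscale l4 v4"
    by (rule span_coords)
  have "wedge u w = (k1 * l2 - k2 * l1) * wedge v1 v2 + (k1 * l3 - k3 * l1) * wedge v1 v3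
    + (k1 * l4 - k4 * l1) * wedge v1 v4 + (k2 * l3 - k3 * l2) * wedge v2 v3
    + (k2 * l4 - k4 * l2) * wedge v2 v4 + (k3 * l4 - k4 * l3) * wedge v3 v4"
    unfolding u w by (simp add: wedge_def zscale_def algebra_simps)
  then show ?thesis using assms by simp
qed

text \<open>Taken with \<open>h = 2\<close>, this passes evenness from the Gram matrix to the middle
  coefficient of \<open>F\<close>.\<close>

lemma polar_Ints:
  assumes "2 * a * a' / h \<in> \<int>" "2 * a * c' / h \<in> \<int>" "2 * c * a' / h \<in> \<int>" "2 * c * c' / h \<in> \<int>"
    and "a * b' / h \<in> \<int>" "c * b' / h \<in> \<int>" "b * a' / h \<in> \<int>" "b * c' / h \<in> \<int>"
    and "s / h \<in> \<int>" "t / h \<in> \<int>"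
  shows "polar F u w / h \<in> \<int>"
proof -
  obtain k1 k2 k3 k4 where u: "u = zscale k1 v1 + zscale k2 v2 + zscale k3 v3 + zscale k4 v4"
    by (rule span_coords)
  obtain l1 l2 l3 l4 where w: "w = zscale l1 v1 + zscale l2 v2 + zscale l3 v3 + zscale l4 v4"
    by (rule span_coords)
  show ?thesis
    unfolding u w polar_add_left polar_add_right polar_zscale_left polar_zscale_right polar_v
      add_divide_distrib times_divide_eq_right[symmetric]
    by (intro Ints_add Ints_mult Ints_of_int assms)
qed

lemma bqf_val_Ints:
  assumes "s \<in> \<int>" "t \<in> \<int>"
  shows "bqf_val F u \<in> \<int>"
proof -
  obtain k1 k2 k3 k4 where u: "u = zscale k1 v1 + zscale k2 v2 + zscale k3 v3 + zscale k4 v4"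
    by (rule span_coords)
  show ?thesis
    unfolding u bqf_val_add bqf_val_zscale polar_add_left polar_zscale_left polar_zscale_right
      polar_v val_v
    by (intro Ints_add Ints_mult Ints_power Ints_of_int assms)
qed

text \<open>If a factor is zero, \<open>s + t\<close> and \<open>s * t\<close> vanish, hence so do
  \<open>s\<close>, \<open>t\<close> and the whole Gram matrix.\<close>

lemma coeffs_eq_0:
  assumes "(a = 0 \<and> b = 0 \<and> c = 0) \<or> (a' = 0 \<and> b' = 0 \<and> c' = 0)"
  shows "F = BQF 0 0 0"
proof -
  have "s + t = 0" "s * t = 0" using assms s_plus_t s_times_t by auto
  then have st: "s = 0" "t = 0" by auto
  have G: "polar F u w = 0" for u w
  proof -
    obtain k1 k2 k3 k4 where u: "u = zscale k1 v1 + zscale k2 v2 + zscale k3 v3 + zscale k4 v4"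
      by (rule span_coords)
    obtain l1 l2 l3 l4 where w: "w = zscale l1 v1 + zscale l2 v2 + zscale l3 v3 + zscale l4 v4"
      by (rule span_coords)
    show ?thesis
      unfolding u w polar_add_left polar_add_right polar_zscale_left polar_zscale_right polar_v
      using assms st by auto
  qed
  show ?thesis
    using G[of "(1,0)" "(1,0)"] G[of "(1,0)" "(0,1)"] G[of "(0,1)" "(0,1)"]
    by (cases F) (simp add: polar_def)
qed

end

section \<open>Primitive factors: integrality, content and parity\<close>

locale primitive_composition = composition +
  assumes prim: "gcd a (gcd b c) = 1" and prim': "gcd a' (gcd b' c') = 1"
begin

lemma disc_scaling:
  obtains e n n' :: int where "disc F = e" "b'\<^sup>2 - 4 * a' * c' = e * n\<^sup>2" "b\<^sup>2 - 4 * a * c = e * n'\<^sup>2"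
    "e \<noteq> 0 \<Longrightarrow> coprime n n'"
proof -
  obtain n :: int where n: "b'\<^sup>2 - 4 * a' * c' = disc F * n\<^sup>2"
    and nw: "disc F \<noteq> 0 \<Longrightarrow>
      wedge v1 v2 = n * a \<and> wedge v1 v4 - wedge v2 v3 = n * b \<and> wedge v3 v4 = n * c"
    using left_scaling[OF prim] by metis
  obtain n' :: int where n': "b\<^sup>2 - 4 * a * c = disc F * n'\<^sup>2"
    and nw': "disc F \<noteq> 0 \<Longrightarrow>
      wedge v1 v3 = n' * a' \<and> wedge v1 v4 + wedge v2 v3 = n' * b' \<and> wedge v2 v4 = n' * c'"
    using right_scaling[OF prim'] by metis
  show thesis
  proof (cases "disc F = 0")
    case True
    have "real_of_int (b'\<^sup>2 - 4 * a' * c') = 0" "real_of_int (b\<^sup>2 - 4 * a * c) = 0"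
      using True n n' by simp_all
    \<comment> \<open>Both discriminants vanish, so with \<open>e = 0\<close> any \<open>n\<close>,
      \<open>n'\<close> serve and coprimality is not demanded.\<close>
    then show thesis using that[of 0 1 1] True by (simp only: of_int_eq_0_iff) simp
  next
    case False
    note w = nw[OF False] and w' = nw'[OF False]
    have cop: "coprime n n'"
    proof (rule ccontr)
      assume "\<not> coprime n n'"
      then have "\<bar>gcd n n'\<bar> \<noteq> 1" by (simp add: coprime_iff_gcd_eq_1)
      then obtain p where p: "prime p" "p dvd gcd n n'" by (metis prime_factor_int)
      then have pn: "p dvd n" "p dvd n'" by simp_all
      have 1: "p dvd wedge v1 v2" "p dvd wedge v3 v4" "p dvd wedge v1 v3" "p dvd wedge v2 v4"
        using w w' pn by simp_all
      have diff: "p dvd wedge v1 v4 - wedge v2 v3" using w pn by simp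
      \<comment> \<open>The prime \<open>p\<close> divides the product of the two middle minors,
        hence one of them, and by \<open>diff\<close> also the other.\<close>
      have "wedge v1 v4 * wedge v2 v3 = wedge v1 v3 * wedge v2 v4 - wedge v1 v2 * wedge v3 v4"
        using wedge_Pluecker[of v1 v2 v3 v4] by linarith
      then have "p dvd wedge v1 v4 * wedge v2 v3" using 1 by simp
      then have "p dvd wedge v1 v4 \<or> p dvd wedge v2 v3"
        using p(1) by (simp add: prime_dvd_mult_iff)
      then have "p dvd wedge v1 v4 \<and> p dvd wedge v2 v3"
      proof
        assume "p dvd wedge v1 v4"
        moreover from dvd_diff[OF this diff] have "p dvd wedge v2 v3" by simp
        ultimately show ?thesis ..
      next
        assume "p dvd wedge v2 v3"
        moreover from dvd_add[OF diff this] have "p dvd wedge v1 v4" by simp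
        ultimately show ?thesis by simp
      qed
      then have "p dvd wedge (1, 0) (0, 1)" using 1 by (blast intro: wedge_dvd)
      then have "p dvd 1" by (simp add: wedge_def)
      then show False using p(1) not_prime_unit by blast
    qed
    then have "gcd (n\<^sup>2) (n'\<^sup>2) = 1" by (intro coprime_imp_gcd_eq_1) simp
    then obtain x y where xy: "x * n\<^sup>2 + y * n'\<^sup>2 = 1"
      using bezout_int[of "n\<^sup>2" "n'\<^sup>2"] by auto
    \<comment> \<open>\<open>F\<close> is not yet known to be integer. Coprimality of the squares
      writes \<open>disc F\<close> as an integer combination of the two integer
      discriminants.\<close>
    define e where "e = x * (b'\<^sup>2 - 4 * a' * c') + y * (b\<^sup>2 - 4 * a * c)"
    have "real_of_int e = disc F * real_of_int (x * n\<^sup>2 + y * n'\<^sup>2)"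
      unfolding e_def of_int_add of_int_mult[of x] of_int_mult[of y] n n'
      by (simp add: algebra_simps)
    then have e: "disc F = e" by (simp add: xy)
    have "real_of_int (b'\<^sup>2 - 4 * a' * c') = real_of_int (e * n\<^sup>2)"
      "real_of_int (b\<^sup>2 - 4 * a * c) = real_of_int (e * n'\<^sup>2)"
      using n n' e by simp_all
    then show thesis using that e cop by (simp only: of_int_eq_iff)
  qed
qed

lemma s_t_Ints: "s \<in> \<int>" "t \<in> \<int>"
proof -
  obtain e n n' :: int where d: "b'\<^sup>2 - 4 * a' * c' = e * n\<^sup>2" "b\<^sup>2 - 4 * a * c = e * n'\<^sup>2"
    using disc_scaling by metis
  \<comment> \<open>\<open>k\<close> is a square root of the discriminant of the monic polynomial
    with roots \<open>s\<close> and \<open>t\<close>.\<close>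
  define k where "k = e * n * n'"
  have k2: "k\<^sup>2 = (b'\<^sup>2 - 4 * a' * c') * (b\<^sup>2 - 4 * a * c)"
    unfolding d k_def by (simp add: power2_eq_square)
  have "(2 * s - b * b')\<^sup>2 = (b * b')\<^sup>2 - 4 * (s * t)"
    using s_plus_t unfolding of_int_mult of_int_power by algebra
  also have "\<dots> = (real_of_int k)\<^sup>2"
    unfolding of_int_power[symmetric] k2 s_times_t by (simp add: power2_eq_square algebra_simps)
  finally have "2 * s - b * b' = k \<or> 2 * s - b * b' = - k"
    by (simp add: power2_eq_iff)
  then obtain j where j: "2 * s = real_of_int (b * b' + j)" "j = k \<or> j = - k"
    by (metis add.commute diff_eq_eq of_int_add of_int_minus)
  \<comment> \<open>Modulo 2 the two discriminants are b^2 and b'^2, so \<open>k\<close> and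
    \<open>b * b'\<close> have equal parity and halving is exact.\<close>
  have "even (k\<^sup>2) \<longleftrightarrow> even (b * b')" unfolding k2 by auto
  then have "even (b * b' + j)" using j(2) by auto
  then obtain i where "b * b' + j = 2 * i" by (rule evenE)
  then have "s = of_int i" using j(1) by simp
  then show "s \<in> \<int>" by simp
  moreover have "t = of_int (b * b') - s" using s_plus_t by linarith
  ultimately show "t \<in> \<int>" by simp
qed

lemma integer_coeffs:
  obtains A B C :: int where "F = BQF A B C"
proof -
  have v: "bqf_val F u \<in> \<int>" for u using bqf_val_Ints s_t_Ints by simp
  have "coeff_a F \<in> \<int>" "coeff_c F \<in> \<int>"
    using v[of "(1,0)"] v[of "(0,1)"] by (simp_all add: bqf_val_def)
  moreover have "coeff_b F = bqf_val F (1,1) - bqf_val F (1,0) - bqf_val F (0,1)"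
    by (simp add: bqf_val_def)
  then have "coeff_b F \<in> \<int>" using v by simp
  ultimately have "integer_form F" by (simp add: integer_form_def)
  then show thesis using that by (auto elim: integer_formE)
qed

text \<open>A common divisor of the coefficients divides all values of \<open>F\<close> and
  \<open>polar F\<close>, hence all nine products of a coefficient of f and one of f'; for
  \<open>b * b'\<close> this uses \<open>s + t\<close>. Multiplying the two Bezout relations writes
  1 as a combination of these products.\<close>

lemma content_eq_1:
  assumes F: "F = BQF (of_int A) (of_int B) (of_int C)"
  shows "gcd A (gcd B C) = 1"
proof -
  define g where "g = gcd A (gcd B C)"
  have g: "g dvd A" "g dvd B" "g dvd C" unfolding g_def by (meson gcd_dvd1 gcd_dvd2 dvd_trans)+
  have val: "g dvd x" if "bqf_val F u = of_int x" for u x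
  proof -
    have "real_of_int x = real_of_int (A * (fst u)\<^sup>2 + B * fst u * snd u + C * (snd u)\<^sup>2)"
      using that by (simp add: F bqf_val_def)
    then show ?thesis using g by (simp only: of_int_eq_iff) simp
  qed
  have pol: "g dvd x" if "polar F u w = of_int x" for u w x
  proof -
    have "real_of_int x = real_of_int (2 * A * fst u * fst w + B * (fst u * snd w + snd u * fst w)
        + 2 * C * snd u * snd w)"
      using that by (simp add: F polar_def)
    then show ?thesis using g by (simp only: of_int_eq_iff) simp
  qed
  obtain s' t' where st: "s = of_int s'" "t = of_int t'" using s_t_Ints by (auto elim!: Ints_cases)
  have "g dvd s'" "g dvd t'" using pol[of v2 v3] pol[of v1 v4] polar_v(4,7) st by simp_all
  moreover have "b * b' = s' + t'" using s_plus_t st by (metis of_int_add of_int_eq_iff)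
  ultimately have bb: "g dvd b * b'" by simp
  note p = val[OF val_v(1)] val[OF val_v(2)] val[OF val_v(3)] val[OF val_v(4)]
    pol[OF polar_v(2)] pol[OF polar_v(3)] pol[OF polar_v(8)] pol[OF polar_v(12)] bb
  obtain r1 r2 r3 where r: "r1 * a + r2 * b + r3 * c = 1" using prim by (rule primitive_Bezout)
  obtain q1 q2 q3 where q: "q1 * a' + q2 * b' + q3 * c' = 1" using prim' by (rule primitive_Bezout)
  have "(r1 * a + r2 * b + r3 * c) * (q1 * a' + q2 * b' + q3 * c') =
     r1 * q1 * (a * a') + r1 * q2 * (a * b') + r1 * q3 * (a * c')
     + r2 * q1 * (b * a') + r2 * q2 * (b * b') + r2 * q3 * (b * c')
     + r3 * q1 * (c * a') + r3 * q2 * (c * b') + r3 * q3 * (c * c')"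
    by (simp add: algebra_simps)
  then have "1 = r1 * q1 * (a * a') + r1 * q2 * (a * b') + r1 * q3 * (a * c')
     + r2 * q1 * (b * a') + r2 * q2 * (b * b') + r2 * q3 * (b * c')
     + r3 * q1 * (c * a') + r3 * q2 * (c * b') + r3 * q3 * (c * c')" using r q by simp
  also have "g dvd \<dots>" by (simp only: dvd_add dvd_mult p)
  finally have "g dvd 1" .
  then show ?thesis by (simp add: g_def)
qed

text \<open>This decides \<open>sigma F\<close>. If \<open>B\<close> is even, so is every value of
  \<open>polar F\<close>; then \<open>b\<close> times each coefficient of f' and \<open>b'\<close>
  times each coefficient of f is even, and primitivity applies. Conversely, even \<open>b\<close>
  and \<open>b'\<close> make the whole Gram matrix even.\<close>

lemma middle_coeff_even_iff:
  assumes F: "F = BQF (of_int A) (of_int B) (of_int C)"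
  shows "even B \<longleftrightarrow> even b \<and> even b'"
proof
  assume B: "even B"
  have pol: "even x" if "polar F u w = of_int x" for u w x
  proof -
    have "real_of_int x = real_of_int (2 * A * fst u * fst w + B * (fst u * snd w + snd u * fst w)
        + 2 * C * snd u * snd w)"
      using that by (simp add: F polar_def)
    then show ?thesis using B by (simp only: of_int_eq_iff) simp
  qed
  obtain s' t' where st: "s = of_int s'" "t = of_int t'" using s_t_Ints by (auto elim!: Ints_cases)
  have "even s'" "even t'" using pol[of v2 v3] pol[of v1 v4] polar_v(4,7) st by simp_all
  moreover have "b * b' = s' + t'" using s_plus_t st by (metis of_int_add of_int_eq_iff)
  ultimately have "even (b * b')" by simp
  moreover note p = pol[OF polar_v(2)] pol[OF polar_v(3)] pol[OF polar_v(8)] pol[OF polar_v(12)]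
  moreover have "\<not> (even a \<and> even b \<and> even c)" "\<not> (even a' \<and> even b' \<and> even c')"
    using prim prim' gcd_greatest[of 2] by fastforce+
  ultimately show "even b \<and> even b'" by auto
next
  assume ev: "even b \<and> even b'"
  then obtain i j where ij: "b = 2 * i" "b' = 2 * j" by (auto elim!: evenE)
  obtain s' t' where st: "s = of_int s'" "t = of_int t'" using s_t_Ints by (auto elim!: Ints_cases)
  have "real_of_int (s' * t') = real_of_int (a' * c' * b\<^sup>2 + a * c * b'\<^sup>2 - 4 * a * c * a' * c')"
    using s_times_t st by simp
  then have "s' * t' = a' * c' * b\<^sup>2 + a * c * b'\<^sup>2 - 4 * a * c * a' * c'"
    by (simp only: of_int_eq_iff)
  then have "even (s' * t')" using ev by simp
  moreover have "b * b' = s' + t'" using s_plus_t st by (metis of_int_add of_int_eq_iff)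
  moreover have "even (b * b')" using ev by simp
  \<comment> \<open>The even product makes one of the two even, the even sum the other.\<close>
  ultimately have "even s'" "even t'" by auto
  then have "s / 2 \<in> \<int>" "t / 2 \<in> \<int>" using st by (auto elim!: evenE)
  then have "polar F (1,0) (0,1) / 2 \<in> \<int>"
    by (intro polar_Ints) (simp_all add: ij)
  then obtain z where "polar F (1,0) (0,1) / 2 = of_int z" by (auto elim: Ints_cases)
  then have "real_of_int B = real_of_int (2 * z)" by (simp add: F polar_def)
  then show "even B" by (simp only: of_int_eq_iff) simp
qed

end

section \<open>Invariants under scaling, and reduction to primitive forms\<close>

lemma signed_gcd_square_multiples:
  assumes "e \<noteq> 0 \<Longrightarrow> coprime n n'"
  shows "signed_gcd (e * n'\<^sup>2) (e * n\<^sup>2) = e"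
proof (cases "e = 0")
  case False
  then have cop: "coprime n n'" by (rule assms)
  have "gcd (e * n'\<^sup>2) (e * n\<^sup>2) = \<bar>e\<bar> * gcd (n'\<^sup>2) (n\<^sup>2)"
    by (simp only: gcd_mult_distrib_int)
  also have "gcd (n'\<^sup>2) (n\<^sup>2) = 1"
    using cop by (intro coprime_imp_gcd_eq_1) (simp add: coprime_commute)
  finally have g: "gcd (e * n'\<^sup>2) (e * n\<^sup>2) = \<bar>e\<bar>" by simp
  \<comment> \<open>For positive \<open>e\<close> some argument is therefore positive, and
    \<open>signed_gcd\<close> takes the positive sign.\<close>
  have "n \<noteq> 0 \<or> n' \<noteq> 0" using cop by auto
  then show ?thesis
    unfolding signed_gcd_def g using False by (auto simp: mult_le_0_iff)
qed (simp add: signed_gcd_def)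

lemma gcd3_mult_left:
  fixes a b c k :: int
  assumes "k > 0"
  shows "gcd (k * a) (gcd (k * b) (k * c)) = k * gcd a (gcd b c)"
  using assms by (simp add: gcd_mult_left abs_mult)

lemma gcd_doubled_primitive:
  fixes a b c :: int
  assumes "gcd a (gcd b c) = 1"
  shows "gcd (2 * a) (gcd b (2 * c)) = (if even b then 2 else 1)"
proof (cases "even b")
  case True
  then obtain i where i: "b = 2 * i" by (rule evenE)
  have "gcd a (gcd i c) dvd gcd a (gcd b c)"
    unfolding i by (intro gcd_greatest) (simp_all add: gcd_dvdI2 dvd_mult)
  then have "gcd a (gcd i c) = 1" using assms by simp
  moreover have "gcd (2 * a) (gcd b (2 * c)) = 2 * gcd a (gcd i c)"
    unfolding i by (rule gcd3_mult_left) simp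
  ultimately show ?thesis using True by simp
next
  case False
  define g where "g = gcd (2 * a) (gcd b (2 * c))"
  have g: "g dvd 2 * a" "g dvd b" "g dvd 2 * c"
    unfolding g_def by (meson gcd_dvd1 gcd_dvd2 dvd_trans)+
  \<comment> \<open>An odd common divisor of \<open>2 * a\<close> and \<open>2 * c\<close> already
    divides \<open>a\<close> and \<open>c\<close>.\<close>
  then have "odd g" using False by (metis dvd_trans)
  then have "coprime g 2" by (simp add: coprime_right_2_iff_odd)
  then have "g dvd a" "g dvd c" using g by (simp_all add: coprime_dvd_mult_right_iff)
  then have "g dvd gcd a (gcd b c)" using g by simp
  then have "g dvd 1" using assms by simp
  then show ?thesis using False by (simp add: g_def)
qed

lemma invariants_of_multiple:
  fixes a b c k :: int
  assumes "gcd a (gcd b c) = 1" "k > 0"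
    and f: "f = BQF (of_int (k * a)) (of_int (k * b)) (of_int (k * c))"
  shows "delta f = k" "sigma f = (if even b then 2 else 1)" "theta f = b\<^sup>2 - 4 * a * c"
proof -
  have "gcd (k * a) (gcd (k * b) (k * c)) = k"
    by (simp add: gcd3_mult_left assms(1,2))
  then show d: "delta f = k" unfolding f invariants_of_int by simp
  have "delta' f = k * gcd (2 * a) (gcd b (2 * c))"
    unfolding f invariants_of_int mult.left_commute[of 2]
    by (rule gcd3_mult_left) (rule assms(2))
  then show "sigma f = (if even b then 2 else 1)"
    using assms(2) unfolding sigma_def d gcd_doubled_primitive[OF assms(1)] by simp
  have "(k * b)\<^sup>2 - 4 * (k * a) * (k * c) = (b\<^sup>2 - 4 * a * c) * k\<^sup>2"
    by (simp add: power2_eq_square algebra_simps)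
  then show "theta f = b\<^sup>2 - 4 * a * c"
    using assms(2) d unfolding f invariants_of_int by simp
qed

lemma integer_form_primitive_multiple:
  assumes "integer_form f" "f \<noteq> BQF 0 0 0"
  obtains a b c k :: int where "gcd a (gcd b c) = 1" "k > 0"
    "f = BQF (of_int (k * a)) (of_int (k * b)) (of_int (k * c))"
proof -
  obtain a b c where f: "f = BQF (real_of_int a) (real_of_int b) (real_of_int c)"
    using assms(1) by (rule integer_formE)
  define k where "k = gcd a (gcd b c)"
  have "k \<noteq> 0" using assms(2) by (auto simp: k_def f)
  then have k: "k > 0" by (simp add: k_def less_le)
  have "k dvd a" "k dvd b" "k dvd c" unfolding k_def by (meson gcd_dvd1 gcd_dvd2 dvd_trans)+
  then obtain a0 b0 c0 where 0: "a = k * a0" "b = k * b0" "c = k * c0" by (auto elim!: dvdE)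
  have "k * gcd a0 (gcd b0 c0) = k"
    using k_def unfolding 0 gcd3_mult_left[OF k] by (rule sym)
  then have "gcd a0 (gcd b0 c0) = 1" using k by simp
  then show thesis using k f by (intro that[of a0 b0 c0 k]) (simp_all only: 0)
qed

text \<open>The map \<open>m\<close> stays the same, so bilinearity and the span condition carry
  over; only the identity between values is divided by \<open>k * k'\<close>.\<close>

lemma composition_law_unscale:
  fixes k k' :: real
  assumes law: "composition_law m (BQF (k * a) (k * b) (k * c)) (BQF (k' * a') (k' * b') (k' * c')) F"
    and "k \<noteq> 0" "k' \<noteq> 0"
  shows "composition_law m (BQF a b c) (BQF a' b' c')
    (BQF (coeff_a F / (k * k')) (coeff_b F / (k * k')) (coeff_c F / (k * k')))"
    (is "composition_law _ ?f ?f' ?F")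
proof -
  have "bqf_val ?F (m x y) = bqf_val ?f x * bqf_val ?f' y" for x y
  proof -
    have "bqf_val F (m x y)
        = bqf_val (BQF (k * a) (k * b) (k * c)) x * bqf_val (BQF (k' * a') (k' * b') (k' * c')) y"
      using law unfolding composition_law_def by blast
    moreover have "bqf_val (BQF (k * a) (k * b) (k * c)) x = k * bqf_val ?f x"
      "bqf_val (BQF (k' * a') (k' * b') (k' * c')) y = k' * bqf_val ?f' y"
      by (simp_all add: bqf_val_def algebra_simps)
    ultimately have "bqf_val F (m x y) = (k * k') * (bqf_val ?f x * bqf_val ?f' y)" by simp
    moreover have "bqf_val F (m x y) = (k * k') * bqf_val ?F (m x y)"
      using assms(2,3) by (simp add: bqf_val_def field_simps)
    ultimately show ?thesis using assms(2,3) by simp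
  qed
  then show ?thesis using law unfolding composition_law_def by blast
qed

section \<open>The invariants of a composed form\<close>

theorem theoremA:
  fixes F f f' :: bqf
  assumes "integer_form f" and "integer_form f'"
    and "composed_of F f f'"
  shows "integer_form F \<and>
    delta F = delta f * delta f' \<and>
    (f \<noteq> BQF 0 0 0 \<and> f' \<noteq> BQF 0 0 0 \<longrightarrow>
       sigma F = min (sigma f) (sigma f') \<and>
       theta F = signed_gcd (theta f) (theta f'))"
proof (cases "f = BQF 0 0 0 \<or> f' = BQF 0 0 0")
  case True
  obtain m where m: "composition_law m f f' F" using assms(3) by (auto simp: composed_of_def)
  obtain a b c where f: "f = BQF (real_of_int a) (real_of_int b) (real_of_int c)"
    using assms(1) by (rule integer_formE)
  obtain a' b' c' where f': "f' = BQF (real_of_int a') (real_of_int b') (real_of_int c')"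
    using assms(2) by (rule integer_formE)
  interpret composition m a b c a' b' c' F using m f f' by unfold_locales simp
  have "F = BQF 0 0 0" using True f f' by (intro coeffs_eq_0) auto
  \<comment> \<open>Only integrality and \<open>delta\<close> are claimed here, and both sides of
    the \<open>delta\<close> equation are 0.\<close>
  then show ?thesis using True by (auto simp: integer_form_def delta_def)
next
  case False
  obtain m where m: "composition_law m f f' F" using assms(3) by (auto simp: composed_of_def)
  obtain a b c k :: int where p: "gcd a (gcd b c) = 1" "k > 0"
    and f: "f = BQF (of_int (k * a)) (of_int (k * b)) (of_int (k * c))"
    using False integer_form_primitive_multiple[OF assms(1)] by metis
  obtain a' b' c' k' :: int where p': "gcd a' (gcd b' c') = 1" "k' > 0"
    and f': "f' = BQF (of_int (k' * a')) (of_int (k' * b')) (of_int (k' * c'))"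
    using False integer_form_primitive_multiple[OF assms(2)] by metis
  \<comment> \<open>Dividing the contents out of f and f' divides \<open>F\<close> by
    \<open>k * k'\<close>. That \<open>F0\<close> is integer comes from the primitive case.\<close>
  define F0 where "F0 = BQF (coeff_a F / (k * k')) (coeff_b F / (k * k')) (coeff_c F / (k * k'))"
  interpret primitive_composition m a b c a' b' c' F0
  proof
    show "composition_law m (BQF a b c) (BQF a' b' c') F0"
      using composition_law_unscale[of m k a b c k' a' b' c' F] m p(2) p'(2)
      unfolding F0_def f f' by simp
  qed (fact p(1) p'(1))+
  obtain A B C where F0: "F0 = BQF (of_int A) (of_int B) (of_int C)" by (rule integer_coeffs)
  have F: "F = BQF (of_int (k * k' * A)) (of_int (k * k' * B)) (of_int (k * k' * C))"
    using F0 p(2) p'(2) unfolding F0_def by (cases F) (simp add: field_simps)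
  have kk: "k * k' > 0" using p(2) p'(2) by simp
  note invF = invariants_of_multiple[OF content_eq_1[OF F0] kk F]
    and invf = invariants_of_multiple[OF p f] and invf' = invariants_of_multiple[OF p' f']
  obtain e n n' where e: "disc F0 = of_int e"
    and d: "b'\<^sup>2 - 4 * a' * c' = e * n\<^sup>2" "b\<^sup>2 - 4 * a * c = e * n'\<^sup>2" "e \<noteq> 0 \<Longrightarrow> coprime n n'"
    using disc_scaling by metis
  have "real_of_int (B\<^sup>2 - 4 * A * C) = of_int e" using e F0 by (simp add: disc_def)
  then have "B\<^sup>2 - 4 * A * C = e" by (simp only: of_int_eq_iff)
  moreover have sg: "signed_gcd (e * n'\<^sup>2) (e * n\<^sup>2) = e"
    using d(3) by (rule signed_gcd_square_multiples)
  ultimately have "theta F = signed_gcd (theta f) (theta f')"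
    unfolding invF invf invf' d by (simp only: sg)
  moreover have "sigma F = min (sigma f) (sigma f')"
    unfolding invF invf invf' using middle_coeff_even_iff[OF F0] by auto
  moreover have "delta F = delta f * delta f'" unfolding invF invf invf' ..
  moreover have "integer_form F" by (simp add: F integer_form_def)
  ultimately show ?thesis by blast
qed

end
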